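(* Suppose $X$ is a random variable with log-concave density $f:[-1,1]\to\mathbb{R}$ such that $\mathbb{E}[X]=0$, and such that $\Pr(X>t)>0$ for every $-1\le t<1$. Then for all $t\in[-1,1)$ with $m_X(t)>0$, $$m_X(t)-t\le\frac{1-m_X(t)^2}{2m_X(t)}.$$ Moreover, the uniform distribution is the extremizing distribution in this case: if $U$ is uniformly distributed on $[-1,1]$, then for all $t\in[-1,1)$, $$\left(m_X(t)-t\right)\frac{m_X(t)}{1-m_X(t)^2}\le\left(m_U(t)-t\right)\frac{m_U(t)}{1-m_U(t)^2}.$$
   Context: For a random variable $Y$ with values in $[-1,1]$ and $\Pr(Y>t)>0$ for $-1\le t<1$, $m_Y(t)=\mathbb{E}[Y\mid Y>t]$. A density $f\ge0$ is log-concave if $f((1-\lambda)x+\lambda y)\ge f(x)^{1-\lambda}f(y)^{\lambda}$ for all $x,y$ in the domain and $\lambda\in(0,1)$. *)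

theory Defs
  imports "HOL-Probability.Probability"
begin

definition cond_mean_above :: "'a measure \<Rightarrow> ('a \<Rightarrow> real) \<Rightarrow> real \<Rightarrow> real" where
  "cond_mean_above M Y t =
     (LINT \<omega>:{\<omega> \<in> space M. Y \<omega> > t}|M. Y \<omega>) / measure M {\<omega> \<in> space M. Y \<omega> > t}"

(* Zeros of f need no special care: the exponents are positive and 0 powr a = 0. *)
definition log_concave_on :: "real set \<Rightarrow> (real \<Rightarrow> real) \<Rightarrow> bool" where
  "log_concave_on S f \<longleftrightarrow> convex S \<and> (\<forall>x\<in>S. 0 \<le> f x) \<and>
     (\<forall>x\<in>S. \<forall>y\<in>S. \<forall>l\<in>{0<..<1}.
        f ((1 - l) * x + l * y) \<ge> f x powr (1 - l) * f y powr l)"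

(* A density f : [-1,1] -> R is a function on the whole line whose values outside [-1,1] are
   ignored; X then lies in [-1,1] almost surely. *)
definition centred_log_concave ::
  "'a measure \<Rightarrow> ('a \<Rightarrow> real) \<Rightarrow> (real \<Rightarrow> real) \<Rightarrow> bool" where
  "centred_log_concave M X f \<longleftrightarrow>
     prob_space M \<and>
     log_concave_on {-1..1} f \<and>
     distributed M lborel X (\<lambda>x. ennreal (indicator {-1..1} x * f x)) \<and>
     (LINT \<omega>|M. X \<omega>) = 0 \<and>
     (\<forall>t. -1 \<le> t \<and> t < 1 \<longrightarrow> measure M {\<omega> \<in> space M. X \<omega> > t} > 0)"

definition uniform_on_pm1 :: "'a measure \<Rightarrow> ('a \<Rightarrow> real) \<Rightarrow> bool" where
  "uniform_on_pm1 N U \<longleftrightarrow> prob_space N \<and>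
     distributed N lborel U (\<lambda>x. indicator {-1..1} x / measure lborel {-1..1::real})"

end

theory Submission
  imports Defs
begin

text \<open>
Write \<open>m\<close> for the conditional mean of \<open>X\<close> above \<open>t\<close>. Everything follows from
\<open>0 \<le> m \<le> (1 + t) / 2\<close>. The uniform distribution has \<open>m = (1 + t) / 2\<close>, so its side of the second
inequality equals \<open>(1 + t) / (3 + t)\<close>, and clearing denominators turns that inequality into
\<open>(2 * m - (1 + t)) * ((2 + t) * m + 1) \<le> 0\<close>. The first inequality follows from
\<open>m - t \<le> 1 - m\<close>, which says again that \<open>m\<close> is at most the midpoint of \<open>[t, 1]\<close>.

The lower bound on \<open>m\<close> holds because conditioning on \<open>X > t\<close> does not lower the mean. The upper
bound, \<open>centred_unimodal_tail_moment_le\<close>, comes from the unimodality of \<open>f\<close>: its values are at least \<open>min (f x) (f z)\<close> between \<open>x\<close> and \<open>z\<close>. Compare \<open>f\<close> with its average \<open>c\<close> over \<open>[t, 1]\<close>.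

If \<open>f t \<ge> c\<close>, then \<open>f - c\<close> changes sign at most once on \<open>[t, 1]\<close>, from plus to minus. Relative to
the constant density of the same mass, \<open>f\<close> has shifted mass to the left there, so its tail mean
is at most that of the constant, the midpoint.

If \<open>f t < c\<close>, then \<open>f\<close> exceeds \<open>f t\<close> somewhere to the right of \<open>t\<close>, and unimodality makes \<open>f\<close>
nondecreasing, hence below \<open>c\<close>, on \<open>[-1, t]\<close>. Therefore the first moment of \<open>f\<close> over \<open>[-1, t]\<close> is at
least that of the constant \<open>c\<close>. Both \<open>f\<close> and \<open>c\<close> have first moment zero over \<open>[-1, 1]\<close>, so the
comparison reverses on \<open>[t, 1]\<close>.
\<close>

section \<open>Unimodality of log-concave functions\<close>

text \<open>A weighted geometric mean of two numbers is at least the smaller one.\<close>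

lemma log_concave_on_imp_quasiconcave:
  assumes "log_concave_on S f" "x \<in> S" "z \<in> S" "x \<le> y" "y \<le> z"
  shows "min (f x) (f z) \<le> f y"
proof (cases "x < y \<and> y < z")
  case False
  then have "y = x \<or> y = z" using assms by auto
  then show ?thesis by auto
next
  case True
  define l where "l = (y - x) / (z - x)"
  have l: "0 < l" "l < 1" using True by (auto simp: l_def field_simps)
  have "l * (z - x) = y - x" using True by (simp add: l_def)
  then have y: "(1 - l) * x + l * z = y" by (simp add: algebra_simps)
  define m where "m = min (f x) (f z)"
  have m: "0 \<le> m" "m \<le> f x" "m \<le> f z"
    using assms by (auto simp: m_def log_concave_on_def)
  have "m = m powr (1 - l) * m powr l"
    using m(1) by (cases "m = 0") (auto simp flip: powr_add)
  also have "\<dots> \<le> f x powr (1 - l) * f z powr l"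
    using m l by (intro mult_mono powr_mono2) auto
  also have "\<dots> \<le> f ((1 - l) * x + l * z)"
    using assms l unfolding log_concave_on_def by auto
  finally show ?thesis by (simp add: y m_def)
qed

section \<open>Tail means of a centred unimodal function\<close>

lemma set_integral_Icc_ident:
  fixes a b :: real
  assumes "a \<le> b"
  shows "(LINT x:{a..b}|lborel. x) = (b\<^sup>2 - a\<^sup>2) / 2"
  using integral_power[OF assms, of 1] assms
  by (simp add: set_lebesgue_integral_def power2_eq_square numeral_2_eq_2 algebra_simps diff_divide_distrib)

lemma set_integrable_ident_mult:
  fixes f :: "real \<Rightarrow> real"
  assumes "set_integrable lborel {a..b} f"
  shows "set_integrable lborel {a..b} (\<lambda>x. x * f x)"
proof -
  have i: "integrable lborel (\<lambda>x. indicator {a..b} x * f x)"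
    using assms by (simp add: set_integrable_def)
  have *: "integrable lborel (\<lambda>x. (\<bar>a\<bar> + \<bar>b\<bar>) * (indicator {a..b} x * f x))"
    using i by (rule integrable_mult_right)
  have m: "(\<lambda>x. x * (indicator {a..b} x * f x)) \<in> borel_measurable lborel"
    using borel_measurable_integrable[OF i] by measurable
  have "integrable lborel (\<lambda>x. x * (indicator {a..b} x * f x))"
  proof (rule Bochner_Integration.integrable_bound[OF * m], rule AE_I2)
    fix x :: real
    show "norm (x * (indicator {a..b} x * f x))
            \<le> norm ((\<bar>a\<bar> + \<bar>b\<bar>) * (indicator {a..b} x * f x))"
      by (cases "x \<in> {a..b}") (auto simp: abs_mult intro!: mult_right_mono)
  qed
  then show ?thesis by (simp add: set_integrable_def algebra_simps)
qed

text \<open>Sign changes of \<open>f - c\<close> at \<open>p\<close> are turned into moment bounds by integrating the product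
\<open>(x - p) * (f x - c)\<close>, whose sign is then constant.\<close>

lemma set_integral_shifted_product:
  fixes f :: "real \<Rightarrow> real"
  assumes f: "set_integrable lborel {a..b} f" and "a \<le> b"
  shows "set_integrable lborel {a..b} (\<lambda>x. (x - p) * (f x - c))"
    and "(LINT x:{a..b}|lborel. (x - p) * (f x - c)) =
           (LINT x:{a..b}|lborel. x * f x) - p * (LINT x:{a..b}|lborel. f x)
           - c * ((b\<^sup>2 - a\<^sup>2) / 2) + p * c * (b - a)"
proof -
  have x: "set_integrable lborel {a..b} (\<lambda>x. x)"
    by (rule borel_integrable_atLeastAtMost') (intro continuous_intros)
  define k where "k = p * c"
  have k: "set_integrable lborel {a..b} (\<lambda>x. k)"
    by (rule borel_integrable_atLeastAtMost') (intro continuous_intros)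
  note i = set_integrable_ident_mult[OF f]
  have eq: "(\<lambda>x. (x - p) * (f x - c)) = (\<lambda>x. ((x * f x - p * f x) - c * x) + k)"
    by (auto simp: k_def algebra_simps)
  show "set_integrable lborel {a..b} (\<lambda>x. (x - p) * (f x - c))"
    unfolding eq by (intro set_integral_add set_integral_diff set_integrable_mult_right i f x k)
  have k1: "(LINT x:{a..b}|lborel. k) = k * (b - a)"
    using \<open>a \<le> b\<close> by (simp add: set_lebesgue_integral_def)
  show "(LINT x:{a..b}|lborel. (x - p) * (f x - c)) =
           (LINT x:{a..b}|lborel. x * f x) - p * (LINT x:{a..b}|lborel. f x)
           - c * ((b\<^sup>2 - a\<^sup>2) / 2) + p * c * (b - a)"
    unfolding eq
    using f x k i
    by (simp add: set_integral_add set_integral_diff set_integral_mult_right set_integrable_mult_right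
         k1 k_def[symmetric] set_integral_Icc_ident[OF \<open>a \<le> b\<close>])
qed

text \<open>Starting at a point where \<open>f\<close> is at least its average \<open>c\<close>, the set \<open>f \<ge> c\<close> is an initial
segment of the interval. So \<open>f - c\<close> changes sign at most once, at some \<open>p\<close>, and since \<open>f - c\<close> has
integral zero, the value of \<open>p\<close> drops out of the moment bound.\<close>

lemma tail_moment_le_of_head_ge_average:
  fixes f :: "real \<Rightarrow> real"
  assumes f: "set_integrable lborel {t..b} f" and "t \<le> b"
    and qc: "\<And>x y z. t \<le> x \<Longrightarrow> x \<le> y \<Longrightarrow> y \<le> z \<Longrightarrow> z \<le> b \<Longrightarrow> min (f x) (f z) \<le> f y"
    and c: "(LINT x:{t..b}|lborel. f x) = c * (b - t)" and "c \<le> f t"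
  shows "(LINT x:{t..b}|lborel. x * f x) \<le> c * ((b\<^sup>2 - t\<^sup>2) / 2)"
proof -
  define S where "S = {x \<in> {t..b}. c \<le> f x}"
  define p where "p = Sup S"
  have S: "t \<in> S" "bdd_above S" using assms by (auto simp: S_def intro: bdd_aboveI[of _ b])
  have "(x - p) * (f x - c) \<le> 0" if x: "x \<in> {t..b}" for x
  proof (cases x p rule: linorder_cases)
    case less
    then obtain s where s: "s \<in> S" "x < s"
      using less_cSup_iff[of S x] S by (auto simp: p_def)
    then have "min (f t) (f s) \<le> f x" using x by (intro qc) (auto simp: S_def)
    then have "c \<le> f x" using s \<open>c \<le> f t\<close> by (auto simp: S_def)
    then show ?thesis using less by (intro mult_nonpos_nonneg) auto
  next
    case greater
    then have "x \<notin> S" using cSup_upper[OF _ S(2), of x] by (auto simp: p_def)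
    then have "f x < c" using x by (auto simp: S_def)
    then show ?thesis using greater by (intro mult_nonneg_nonpos) auto
  qed auto
  then have "(LINT x:{t..b}|lborel. (x - p) * (f x - c)) \<le> (LINT x:{t..b}|lborel. 0)"
    using set_integral_shifted_product(1)[OF f \<open>t \<le> b\<close>]
    by (intro set_integral_mono) (auto simp: set_integrable_def)
  then show ?thesis
    using set_integral_shifted_product(2)[OF f \<open>t \<le> b\<close>, of p c] c
    by (simp add: set_lebesgue_integral_def)
qed

text \<open>The conclusion says that the barycentre of \<open>f\<close> over \<open>[t, 1]\<close> does not exceed the midpoint.
This can fail without the centring hypothesis, for instance for \<open>f x = x + 1\<close>, so the case
\<open>f t < c\<close> has to use the behaviour of \<open>f\<close> on the left of \<open>t\<close>.\<close>

theorem centred_unimodal_tail_moment_le: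
  fixes f :: "real \<Rightarrow> real"
  assumes f: "set_integrable lborel {-1..1} f"
    and qc: "\<And>x y z. -1 \<le> x \<Longrightarrow> x \<le> y \<Longrightarrow> y \<le> z \<Longrightarrow> z \<le> 1 \<Longrightarrow> min (f x) (f z) \<le> f y"
    and centred: "(LINT x:{-1..1}|lborel. x * f x) = 0"
    and t: "-1 \<le> t" "t < 1"
  shows "(LINT x:{t..1}|lborel. x * f x) \<le> (1 + t) / 2 * (LINT x:{t..1}|lborel. f x)"
proof -
  define c where "c = (LINT x:{t..1}|lborel. f x) / (1 - t)"
  have c: "(LINT x:{t..1}|lborel. f x) = c * (1 - t)" using t by (simp add: c_def)
  have R: "set_integrable lborel {t..1} f" and L: "set_integrable lborel {-1..t} f"
    using t by (auto intro: set_integrable_subset[OF f])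
  have "(LINT x:{t..1}|lborel. x * f x) \<le> c * ((1\<^sup>2 - t\<^sup>2) / 2)"
  proof (cases "c \<le> f t")
    case True
    then show ?thesis
      using t by (intro tail_moment_le_of_head_ge_average[OF R _ _ c]) (auto intro: qc)
  next
    case False
    have const: "set_integrable lborel {t..1} (\<lambda>_. f t)"
      by (rule borel_integrable_atLeastAtMost') (intro continuous_intros)
    have "\<exists>y\<in>{t..1}. f t < f y"
    proof (rule ccontr)
      assume "\<not> ?thesis"
      then have "(LINT x:{t..1}|lborel. f x) \<le> (LINT x:{t..1}|lborel. f t)"
        using R const by (intro set_integral_mono) (auto simp: not_less)
      also have "\<dots> = f t * (1 - t)" using t by (simp add: set_lebesgue_integral_def)
      also have "\<dots> < c * (1 - t)" using False t by simp
      finally show False using c by simp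
    qed
    then obtain y where y: "t \<le> y" "y \<le> 1" "f t < f y" by auto
    have mono: "f u \<le> f v" if "-1 \<le> u" "u \<le> v" "v \<le> t" for u v
      using qc[of v t y] qc[of u v y] that y by (auto simp: min_def split: if_splits)
    \<comment> \<open>The sign of \<open>x\<close> changes at \<open>0\<close>. With \<open>f u\<close> as the constant, \<open>x * (f x - f u)\<close> is
      nonnegative on both sides of \<open>u\<close>; if \<open>0\<close> lies beyond \<open>t\<close>, the endpoint \<open>t\<close> takes its place.\<close>
    define u where "u = min 0 t"
    have u: "-1 \<le> u" "u \<le> t" using t by (auto simp: u_def)
    have "0 \<le> (x - 0) * (f x - f u)" if x: "x \<in> {-1..t}" for x
    proof (cases "x \<le> u")
      case True
      then show ?thesis using mono[of x u] x u
        by (intro mult_nonpos_nonpos) (auto simp: u_def)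
    next
      case False
      then show ?thesis using mono[of u x] x u
        by (intro mult_nonneg_nonneg) (auto simp: u_def min_def split: if_splits)
    qed
    then have "(LINT x:{-1..t}|lborel. 0) \<le> (LINT x:{-1..t}|lborel. (x - 0) * (f x - f u))"
      by (intro set_integral_mono set_integral_shifted_product(1)[OF L t(1)])
        (auto simp: set_integrable_def)
    then have "f u * ((t\<^sup>2 - 1) / 2) \<le> (LINT x:{-1..t}|lborel. x * f x)"
      using set_integral_shifted_product(2)[OF L t(1), of 0 "f u"]
      by (simp add: set_lebesgue_integral_def)
    \<comment> \<open>The constant may be raised from \<open>f u\<close> to \<open>c\<close>: the first moment
      \<open>(t\<^sup>2 - 1) / 2\<close> of \<open>[-1, t]\<close> is not positive.\<close>
    moreover have "c * ((t\<^sup>2 - 1) / 2) \<le> f u * ((t\<^sup>2 - 1) / 2)"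
      using False mono[of u t] u t by (intro mult_right_mono_neg) (auto simp: abs_square_le_1)
    moreover have "(LINT x:{-1..1}|lborel. x * f x)
        = (LINT x:{-1..t}|lborel. x * f x) + (LINT x:{t..1}|lborel. x * f x)"
    proof -
      have AE: "AE x in lborel. \<not> (x \<in> {-1..t} \<and> x \<in> {t..1})"
        using AE_lborel_singleton[of t] by eventually_elim auto
      have "{-1..1} = {-1..t} \<union> {t..1}" using t by auto
      then show ?thesis
        using set_integral_Un_AE[OF AE _ _ set_integrable_ident_mult[OF L] set_integrable_ident_mult[OF R]]
        by simp
    qed
    ultimately have "(LINT x:{t..1}|lborel. x * f x) \<le> - (c * ((t\<^sup>2 - 1) / 2))"
      using centred by linarith
    also have "\<dots> = c * ((1\<^sup>2 - t\<^sup>2) / 2)" by (simp add: field_simps)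
    finally show ?thesis .
  qed
  also have "\<dots> = (1 + t) / 2 * (LINT x:{t..1}|lborel. f x)"
    unfolding c by (simp add: power2_eq_square field_simps)
  finally show ?thesis .
qed

section \<open>Conditional means of a random variable with a density\<close>

text \<open>The tail \<open>X > t\<close> corresponds to the half-open interval from \<open>t\<close> to \<open>b\<close>; closing it changes
the integrals by a null set and makes the formulas for compact intervals applicable.\<close>

lemma distributed_on_Icc_moments:
  fixes f :: "real \<Rightarrow> real"
  assumes M: "prob_space M"
    and X: "distributed M lborel X (\<lambda>x. ennreal (indicator {a..b} x * f x))"
    and nonneg: "\<And>x. x \<in> {a..b} \<Longrightarrow> 0 \<le> f x"
  shows "set_integrable lborel {a..b} f"
    and "(LINT \<omega>|M. X \<omega>) = (LINT x:{a..b}|lborel. x * f x)"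
    and "a \<le> t \<Longrightarrow> (LINT \<omega>:{\<omega> \<in> space M. X \<omega> > t}|M. X \<omega>) = (LINT x:{t..b}|lborel. x * f x)"
    and "a \<le> t \<Longrightarrow> measure M {\<omega> \<in> space M. X \<omega> > t} = (LINT x:{t..b}|lborel. f x)"
proof -
  interpret prob_space M by fact
  define h where "h = (\<lambda>x. indicator {a..b} x * f x)"
  have h0: "0 \<le> h x" for x using nonneg by (auto simp: h_def indicator_def)
  have X': "distributed M lborel X (\<lambda>x. ennreal (h x))" using X by (simp add: h_def)
  have [measurable]: "X \<in> borel_measurable M" using distributed_measurable[OF X] by simp
  have int: "(LINT x|lborel. h x * g x) = (LINT \<omega>|M. g (X \<omega>))"
    if "g \<in> borel_measurable lborel" for g :: "real \<Rightarrow> real"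
    using distributed_integral[OF X' that] h0 by simp
  have "integrable lborel (\<lambda>x. h x * 1)"
    using distributed_integrable[OF X', of "\<lambda>_. 1"] h0 by simp
  then show "set_integrable lborel {a..b} f" by (simp add: set_integrable_def h_def)
  show "(LINT \<omega>|M. X \<omega>) = (LINT x:{a..b}|lborel. x * f x)"
    using int[of "\<lambda>x. x"] by (simp add: set_lebesgue_integral_def h_def algebra_simps)
  have tail: "(LINT \<omega>:{\<omega> \<in> space M. X \<omega> > t}|M. g (X \<omega>)) = (LINT x:{t..b}|lborel. g x * f x)"
    if "a \<le> t" and [measurable]: "g \<in> borel_measurable borel" for g :: "real \<Rightarrow> real"
  proof -
    have [measurable]: "h \<in> borel_measurable borel"
      using distributed_real_measurable[OF _ X'] h0 by simp
    have h_eq: "indicator {t..b} x * (g x * f x) = indicator {t..b} x * g x * h x" for x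
      using \<open>a \<le> t\<close> by (auto simp: h_def indicator_def)
    have "(LINT \<omega>:{\<omega> \<in> space M. X \<omega> > t}|M. g (X \<omega>))
        = (LINT \<omega>|M. indicator {t<..} (X \<omega>) * g (X \<omega>))"
      unfolding set_lebesgue_integral_def
      by (intro Bochner_Integration.integral_cong) (auto simp: indicator_def)
    also have "\<dots> = (LINT x|lborel. h x * (indicator {t<..} x * g x))"
      by (rule int[symmetric]) measurable
    also have "\<dots> = (LINT x|lborel. indicator {t..b} x * g x * h x)"
    proof (rule integral_cong_AE)
      show "AE x in lborel. h x * (indicator {t<..} x * g x) = indicator {t..b} x * g x * h x"
        using AE_lborel_singleton[of t] by eventually_elim (auto simp: h_def indicator_def)
    qed measurable
    also have "\<dots> = (LINT x:{t..b}|lborel. g x * f x)"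
      by (simp add: set_lebesgue_integral_def h_eq)
    finally show ?thesis .
  qed
  show "a \<le> t \<Longrightarrow> (LINT \<omega>:{\<omega> \<in> space M. X \<omega> > t}|M. X \<omega>) = (LINT x:{t..b}|lborel. x * f x)"
    using tail[of "\<lambda>x. x"] by simp
  show "measure M {\<omega> \<in> space M. X \<omega> > t} = (LINT x:{t..b}|lborel. f x)" if "a \<le> t"
    using tail[of "\<lambda>_. 1"] that by (simp add: set_lebesgue_integral_def)
qed

text \<open>For \<open>t \<ge> 0\<close> the integrand is nonnegative. For \<open>t < 0\<close> the discarded part, where \<open>X \<le> t\<close>,
contributes a nonpositive amount to a total of zero.\<close>

lemma cond_mean_above_nonneg:
  assumes "integrable M X" and mean: "(LINT \<omega>|M. X \<omega>) = 0"
  shows "0 \<le> cond_mean_above M X t"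
proof -
  define A where "A = {\<omega> \<in> space M. X \<omega> > t}"
  have [measurable]: "X \<in> borel_measurable M" using assms by auto
  have A[measurable]: "A \<in> sets M" unfolding A_def by measurable
  have i: "integrable M (\<lambda>\<omega>. indicator A \<omega> * X \<omega>)"
    using integrable_mult_indicator[OF A assms(1)] by simp
  have "0 \<le> (LINT \<omega>|M. indicator A \<omega> * X \<omega>)"
  proof (cases "0 \<le> t")
    case True
    then show ?thesis by (intro integral_nonneg_AE AE_I2) (auto simp: A_def indicator_def)
  next
    case False
    have "(LINT \<omega>|M. X \<omega>) \<le> (LINT \<omega>|M. indicator A \<omega> * X \<omega>)"
      using False by (intro integral_mono assms i) (auto simp: A_def indicator_def)
    then show ?thesis using mean by simp
  qed
  then show ?thesis
    by (simp add: cond_mean_above_def set_lebesgue_integral_def A_def)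
qed

lemma cond_mean_above_le_midpoint:
  assumes X: "centred_log_concave M X f" and t: "-1 \<le> t" "t < 1"
  shows "0 \<le> cond_mean_above M X t" "cond_mean_above M X t \<le> (1 + t) / 2"
proof -
  have M: "prob_space M" and lc: "log_concave_on {-1..1} f"
    and d: "distributed M lborel X (\<lambda>x. ennreal (indicator {-1..1} x * f x))"
    and mean: "(LINT \<omega>|M. X \<omega>) = 0"
    and pos: "measure M {\<omega> \<in> space M. X \<omega> > t} > 0"
    using X t by (auto simp: centred_log_concave_def)
  have nonneg: "0 \<le> f x" if "x \<in> {-1..1}" for x using lc that by (auto simp: log_concave_on_def)
  note m = distributed_on_Icc_moments[OF M d nonneg]
  have "set_integrable lborel {-1..1} (\<lambda>x. x * f x)" using m(1) by (rule set_integrable_ident_mult) auto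
  then have "integrable lborel (\<lambda>x. (indicator {-1..1} x * f x) * x)"
    by (simp add: set_integrable_def algebra_simps)
  then have "integrable M X"
    using distributed_integrable[OF d, of "\<lambda>x. x"] nonneg by (auto simp: indicator_def)
  then show "0 \<le> cond_mean_above M X t" using mean by (rule cond_mean_above_nonneg)
  have "(LINT x:{t..1}|lborel. x * f x) \<le> (1 + t) / 2 * (LINT x:{t..1}|lborel. f x)"
  proof (rule centred_unimodal_tail_moment_le[OF m(1) _ _ t])
    show "(LINT x:{-1..1}|lborel. x * f x) = 0" using m(2) mean by auto
  qed (auto intro: log_concave_on_imp_quasiconcave[OF lc])
  then show "cond_mean_above M X t \<le> (1 + t) / 2"
    unfolding cond_mean_above_def using pos m(3)[of t] m(4)[of t] t
    by (simp add: pos_divide_le_eq)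
qed

lemma uniform_on_pm1_extremal:
  assumes U: "uniform_on_pm1 N U"
  shows "centred_log_concave N U (\<lambda>_. 1/2)"
    and "-1 \<le> t \<Longrightarrow> t < 1 \<Longrightarrow> cond_mean_above N U t = (1 + t) / 2"
proof -
  have N: "prob_space N" using U by (simp add: uniform_on_pm1_def)
  have "(\<lambda>x. ennreal (indicator {-1..1} x / measure lborel {-1..1::real}))
      = (\<lambda>x. ennreal (indicator {-1..1} x * (1/2)))" by simp
  then have d: "distributed N lborel U (\<lambda>x. ennreal (indicator {-1..1} x * (1/2)))"
    using U unfolding uniform_on_pm1_def by simp
  note m = distributed_on_Icc_moments[OF N d]
  have I1: "(LINT x:{s..1}|lborel. x * (1/2)) = (1 - s\<^sup>2) / 4" if "s \<le> 1" for s :: real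
    using set_integral_Icc_ident[OF that] by simp
  have I0: "(LINT x:{s..1}|lborel. 1/2) = (1 - s) / 2" if "s \<le> 1" for s :: real
    using that by (simp add: set_lebesgue_integral_def)
  have prob: "measure N {\<omega> \<in> space N. U \<omega> > s} = (1 - s) / 2" if "-1 \<le> s" "s < 1" for s
    using m(4)[of s] I0[of s] that by simp
  have pos: "0 < measure N {\<omega> \<in> space N. U \<omega> > s}" if "-1 \<le> s" "s < 1" for s
    unfolding prob[OF that] using that by simp
  have "log_concave_on {-1..1} (\<lambda>_. 1/2)"
    by (auto simp: log_concave_on_def simp flip: powr_add)
  then show "centred_log_concave N U (\<lambda>_. 1/2)"
    using N d m(2) I1[of "-1"] pos by (auto simp: centred_log_concave_def)
  show "cond_mean_above N U t = (1 + t) / 2" if t: "-1 \<le> t" "t < 1"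
  proof -
    have "(LINT \<omega>:{\<omega> \<in> space N. U \<omega> > t}|N. U \<omega>) = (1 - t\<^sup>2) / 4"
      using m(3)[of t] I1[of t] t by simp
    also have "\<dots> = (1 + t) / 2 * ((1 - t) / 2)" by (simp add: power2_eq_square field_simps)
    finally show ?thesis unfolding cond_mean_above_def prob[OF t] using t by (simp add: divide_simps)
  qed
qed

section \<open>The inequality and its extremizer\<close>

theorem proposition3p5:
  fixes M :: "'a measure" and X :: "'a \<Rightarrow> real" and f :: "real \<Rightarrow> real"
  assumes "centred_log_concave M X f"
  shows "(\<forall>t\<in>{-1..<1}. cond_mean_above M X t > 0 \<longrightarrow>
            cond_mean_above M X t - t
              \<le> (1 - (cond_mean_above M X t)\<^sup>2) / (2 * cond_mean_above M X t))
       \<and> (\<forall>(N :: 'b measure) U. uniform_on_pm1 N U \<longrightarrow>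
            centred_log_concave N U (\<lambda>_. 1/2) \<and>
            (\<forall>t\<in>{-1..<1}.
               (cond_mean_above M X t - t)
                   * (cond_mean_above M X t / (1 - (cond_mean_above M X t)\<^sup>2))
               \<le> (cond_mean_above N U t - t)
                   * (cond_mean_above N U t / (1 - (cond_mean_above N U t)\<^sup>2))))"
proof (intro conjI ballI allI impI)
  fix t :: real assume t: "t \<in> {-1..<1}" and pos: "cond_mean_above M X t > 0"
  define m where "m = cond_mean_above M X t"
  have m: "m \<le> (1 + t) / 2" "0 < m"
    using cond_mean_above_le_midpoint[OF assms, of t] t pos by (auto simp: m_def)
  \<comment> \<open>After \<open>m - t \<le> 1 - m\<close>, the remaining gap is \<open>(1 - m)\<^sup>2\<close>.\<close>
  have "2 * m * (m - t) \<le> 2 * m * (1 - m)" using m by (intro mult_left_mono) auto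
  also have "\<dots> \<le> 1 - m\<^sup>2" using zero_le_power2[of "1 - m"] by (simp add: power2_eq_square algebra_simps)
  finally show "cond_mean_above M X t - t
      \<le> (1 - (cond_mean_above M X t)\<^sup>2) / (2 * cond_mean_above M X t)"
    using m by (simp add: pos_le_divide_eq mult.commute flip: m_def)
next
  fix N :: "'b measure" and U assume U: "uniform_on_pm1 N U"
  show "centred_log_concave N U (\<lambda>_. 1/2)" using U by (rule uniform_on_pm1_extremal)
  fix t :: real assume "t \<in> {-1..<1}"
  then have t: "-1 \<le> t" "t < 1" by auto
  define m where "m = cond_mean_above M X t"
  have m: "m \<le> (1 + t) / 2" "0 \<le> m"
    using cond_mean_above_le_midpoint[OF assms t] by (auto simp: m_def)
  have "m < 1" using m t by auto
  then have m2: "0 < 1 - m\<^sup>2" using m by (simp add: power_less_one_iff abs_square_less_1)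
  have u: "cond_mean_above N U t = (1 + t) / 2" using uniform_on_pm1_extremal(2)[OF U t] .
  have sq: "1 - ((1 + t) / 2)\<^sup>2 = (1 - t) / 2 * ((3 + t) / 2)" by (simp add: power2_eq_square field_simps)
  have rhs: "((1 + t) / 2 - t) * ((1 + t) / 2 / (1 - ((1 + t) / 2)\<^sup>2)) = (1 + t) / (3 + t)"
    unfolding sq using t by (simp add: divide_simps) (simp add: algebra_simps)
  \<comment> \<open>The quadratic in \<open>m\<close> that results from clearing denominators has the uniform value
    \<open>(1 + t) / 2\<close> as its only nonnegative root.\<close>
  have "(2 * m - (1 + t)) * ((2 + t) * m + 1) \<le> 0"
    using m t by (intro mult_nonpos_nonneg) auto
  then have "(m - t) * m * (3 + t) \<le> (1 + t) * (1 - m\<^sup>2)"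
    by (simp add: power2_eq_square algebra_simps)
  then have "(m - t) * (m / (1 - m\<^sup>2)) \<le> (1 + t) / (3 + t)"
    using m2 t by (simp add: divide_simps)
  then show "(cond_mean_above M X t - t)
                   * (cond_mean_above M X t / (1 - (cond_mean_above M X t)\<^sup>2))
               \<le> (cond_mean_above N U t - t)
                   * (cond_mean_above N U t / (1 - (cond_mean_above N U t)\<^sup>2))"
    unfolding u rhs m_def .
qed

end
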